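(* Let $f_1(\boldsymbol x),\dots,f_K(\boldsymbol x)$ be the Softmax outputs of a fixed trained classifier (strictly positive functions of the input $\boldsymbol x$ with $\sum_{k}f_k(\boldsymbol x)=1$), let $\hat y=\hat y(\boldsymbol x)\in\arg\max_{k\in\{1,\dots,K\}} f_k(\boldsymbol x)$, and for $\beta>0$ let $l_k^{\mathrm{soft}}(\hat y)$ be the soft labels of $\hat y$ with parameter $\beta$ (defined in the context). Then, in the limit $\beta\to+\infty$, detecting anomalies by thresholding the hierarchically consistent score is equivalent to thresholding the maximum Softmax probability: for every real threshold $c$ there is a constant $c'>0$ (not depending on $\boldsymbol x$) such that for every input $\boldsymbol x$, $$\lim_{\beta\to+\infty}\Bigl(-\sum_{k=1}^{K} l_k^{\mathrm{soft}}(\hat y)\log f_k(\boldsymbol x)\Bigr)>c\quad\Longleftrightarrow\quad \max_{k\in\{1,\dots,K\}} f_k(\boldsymbol x)<c' .$$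
   Context: The $K$ classes $\{1,\dots,K\}$ are the leaves of a given finite rooted tree $\mathcal T$ (a taxonomy) of height $h_{\mathcal T}\ge 1$. For leaves $i,j$, $LCA(i,j)$ denotes the height in $\mathcal T$ of the lowest common ancestor of $i$ and $j$ (height of a node = length of a longest downward path from it to a leaf, so $LCA(i,i)=0$ and $LCA(i,j)\ge 1$ for $i\ne j$), and $d(i,j)=LCA(i,j)/h_{\mathcal T}$. For a parameter $\beta>0$, the soft labels are $$l_k^{\mathrm{soft}}(i)=\frac{\exp(-\beta d(k,i))}{\sum_{j=1}^{K}\exp(-\beta d(j,i))}.$$ The classifier outputs $f_k$ do not depend on $\beta$. *)

theory Defs
  imports Complex_Main
begin

text \<open>
  A finite tree with vertex set \<open>V\<close> and root \<open>r\<close>; the pairs in \<open>E\<close> go from parent to child, so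
  \<open>(u, v) \<in> E\<^sup>*\<close> means that \<open>u\<close> is an ancestor of \<open>v\<close> (every vertex being an ancestor of itself).
\<close>

locale rooted_tree =
  fixes V :: "'v set" and E :: "('v \<times> 'v) set" and r :: 'v
  assumes finite_V: "finite V"
    and root_in_V: "r \<in> V"
    and E_subset: "E \<subseteq> V \<times> V"
    and root_no_parent: "(u, r) \<notin> E"
    and unique_parent: "v \<in> V \<Longrightarrow> v \<noteq> r \<Longrightarrow> \<exists>!u. (u, v) \<in> E"
    and reachable: "v \<in> V \<Longrightarrow> (r, v) \<in> E\<^sup>*"

definition leaves :: "'v set \<Rightarrow> ('v \<times> 'v) set \<Rightarrow> 'v set" where
  "leaves V E = {v \<in> V. \<forall>w. (v, w) \<notin> E}"

definition height :: "'v set \<Rightarrow> ('v \<times> 'v) set \<Rightarrow> 'v \<Rightarrow> nat" where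
  "height V E v = Max {n. \<exists>l \<in> leaves V E. (v, l) \<in> E ^^ n}"

definition lowest_common_ancestor :: "('v \<times> 'v) set \<Rightarrow> 'v \<Rightarrow> 'v \<Rightarrow> 'v" where
  "lowest_common_ancestor E u v =
     (THE a. (a, u) \<in> E\<^sup>* \<and> (a, v) \<in> E\<^sup>* \<and>
             (\<forall>b. (b, u) \<in> E\<^sup>* \<and> (b, v) \<in> E\<^sup>* \<longrightarrow> (b, a) \<in> E\<^sup>*))"

definition LCA :: "'v set \<Rightarrow> ('v \<times> 'v) set \<Rightarrow> 'v \<Rightarrow> 'v \<Rightarrow> nat" where
  "LCA V E u v = height V E (lowest_common_ancestor E u v)"

definition tree_dist :: "'v set \<Rightarrow> ('v \<times> 'v) set \<Rightarrow> 'v \<Rightarrow> 'v \<Rightarrow> 'v \<Rightarrow> real" where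
  "tree_dist V E r u v = real (LCA V E u v) / real (height V E r)"

text \<open>
  Classes are the numbers \<open>1, \<dots>, K\<close>, and \<open>d i j\<close> is a dissimilarity of classes.
\<close>

definition soft_label :: "nat \<Rightarrow> (nat \<Rightarrow> nat \<Rightarrow> real) \<Rightarrow> real \<Rightarrow> nat \<Rightarrow> nat \<Rightarrow> real" where
  "soft_label K d \<beta> k i = exp (- \<beta> * d k i) / (\<Sum>j = 1..K. exp (- \<beta> * d j i))"

text \<open>
  The cross-entropy of the outputs \<open>p\<close> for a single input against the soft labels of class \<open>y\<close>.
\<close>

definition hierarchical_score ::
  "nat \<Rightarrow> (nat \<Rightarrow> nat \<Rightarrow> real) \<Rightarrow> real \<Rightarrow> (nat \<Rightarrow> real) \<Rightarrow> nat \<Rightarrow> real" where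
  "hierarchical_score K d \<beta> p y = - (\<Sum>k = 1..K. soft_label K d \<beta> k y * ln (p k))"

end

theory Submission
  imports Defs
begin

text \<open>
  As \<open>\<beta>\<close> grows, the soft labels of a class \<open>y\<close> concentrate on the classes at distance \<open>0\<close> from \<open>y\<close>.
  Distinct leaves have positive distance, so the only such class is \<open>y\<close> itself and the score tends
  to \<open>- ln (f y)\<close>, the negative logarithm of the maximal output; hence \<open>c' = exp (- c)\<close>.
\<close>

section \<open>Paths, depths and common ancestors in a rooted tree\<close>

context rooted_tree
begin

lemma single_valued_converse: "single_valued (E\<inverse>)"
proof (rule single_valuedI)
  fix v u w assume "(v, u) \<in> E\<inverse>" "(v, w) \<in> E\<inverse>"
  moreover from this have "v \<in> V" "v \<noteq> r"
    using E_subset root_no_parent by auto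
  ultimately show "u = w"
    using unique_parent[of v] by auto
qed

text \<open>Since parents are unique, there is only one way to walk up from \<open>v\<close>, so
  both ancestors lie on the same chain.\<close>

lemma ancestors_comparable:
  assumes "(a, v) \<in> E\<^sup>*" "(b, v) \<in> E\<^sup>*"
  shows "(a, b) \<in> E\<^sup>* \<or> (b, a) \<in> E\<^sup>*"
  using single_valued_confluent[OF single_valued_converse, of v a b] assms
  by (auto simp: rtrancl_converse)

text \<open>Both paths end with the same edge because parents are unique, so the last edges can be
  stripped off together. A path of length 0 cannot face a longer one, as the root has no parent.
  This makes the \<open>THE\<close> in \<open>depth\<close> well defined.\<close>

lemma root_path_length_unique:
  assumes "(r, v) \<in> E ^^ m" "(r, v) \<in> E ^^ n"
  shows "m = n"
  using assms
proof (induction m arbitrary: n v)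
  case 0
  then show ?case
    using root_no_parent by (cases n) auto
next
  case (Suc m)
  then obtain u where u: "(r, u) \<in> E ^^ m" "(u, v) \<in> E"
    by auto
  with Suc.prems(2) root_no_parent obtain n' where n': "n = Suc n'"
    by (cases n) auto
  then obtain w where w: "(r, w) \<in> E ^^ n'" "(w, v) \<in> E"
    using Suc.prems(2) by auto
  have "w = u"
    using single_valuedD[OF single_valued_converse, of v w u] u w by simp
  then show ?case
    using Suc.IH u w n' by auto
qed

definition depth :: "'v \<Rightarrow> nat" where
  "depth v = (THE n. (r, v) \<in> E ^^ n)"

lemma depth_eqI: "(r, v) \<in> E ^^ n \<Longrightarrow> depth v = n"
  unfolding depth_def using root_path_length_unique by blast

lemma depth_path:
  assumes "u \<in> V" "(u, v) \<in> E ^^ n"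
  shows "depth v = depth u + n"
proof -
  obtain m where m: "(r, u) \<in> E ^^ m"
    using reachable[OF assms(1)] rtrancl_power by blast
  with assms(2) have "(r, v) \<in> E ^^ (m + n)"
    by (auto simp: relpow_add)
  with m show ?thesis
    by (simp add: depth_eqI)
qed

text \<open>\<open>height\<close> is a \<open>Max\<close>, which gives useful bounds only over a
  finite set. A path from \<open>v\<close> to \<open>l\<close> must have length
  \<open>depth l - depth v\<close>, so there are at most as many lengths as leaves.\<close>

lemma finite_path_lengths:
  assumes "v \<in> V"
  shows "finite {n. \<exists>l \<in> leaves V E. (v, l) \<in> E ^^ n}"
proof (rule finite_subset)
  show "{n. \<exists>l \<in> leaves V E. (v, l) \<in> E ^^ n} \<subseteq> (\<lambda>l. depth l - depth v) ` leaves V E"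
  proof
    fix n assume "n \<in> {n. \<exists>l \<in> leaves V E. (v, l) \<in> E ^^ n}"
    then obtain l where "l \<in> leaves V E" "(v, l) \<in> E ^^ n"
      by blast
    then show "n \<in> (\<lambda>l. depth l - depth v) ` leaves V E"
      using depth_path[OF assms] by (intro image_eqI[of _ _ l]) auto
  qed
  show "finite ((\<lambda>l. depth l - depth v) ` leaves V E)"
    using finite_V by (simp add: leaves_def)
qed

lemma ancestor_in_V: "(a, v) \<in> E\<^sup>* \<Longrightarrow> v \<in> V \<Longrightarrow> a \<in> V"
  by (induction rule: converse_rtrancl_induct) (use E_subset in auto)

text \<open>Each edge of a downward path raises the depth by one, so under the depth hypothesis the
  path from \<open>a\<close> to \<open>b\<close> is empty.\<close>

lemma ancestor_antisym:
  assumes "a \<in> V" "(a, b) \<in> E\<^sup>*" "depth b \<le> depth a"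
  shows "a = b"
proof -
  obtain n where n: "(a, b) \<in> E ^^ n"
    using assms(2) rtrancl_power by blast
  then have "n = 0"
    using depth_path[OF assms(1)] assms(3) by fastforce
  with n show ?thesis
    by simp
qed

lemma depth_mono: "u \<in> V \<Longrightarrow> (u, v) \<in> E\<^sup>* \<Longrightarrow> depth u \<le> depth v"
  by (auto simp: rtrancl_power dest: depth_path)

text \<open>The \<open>THE\<close> is justified by a common ancestor \<open>m\<close> of maximal
  depth: any other one is comparable with \<open>m\<close> and cannot lie strictly below it.
  Comparing depths also gives uniqueness.\<close>

lemma lowest_common_ancestor_ancestor:
  assumes "u \<in> V" "v \<in> V"
  defines "a \<equiv> lowest_common_ancestor E u v"
  shows "(a, u) \<in> E\<^sup>*" "(a, v) \<in> E\<^sup>*"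
    and "\<And>b. (b, u) \<in> E\<^sup>* \<Longrightarrow> (b, v) \<in> E\<^sup>* \<Longrightarrow> (b, a) \<in> E\<^sup>*"
proof -
  let ?C = "{b. (b, u) \<in> E\<^sup>* \<and> (b, v) \<in> E\<^sup>*}"
  have CV: "?C \<subseteq> V"
    using ancestor_in_V assms by blast
  have fin: "finite (depth ` ?C)"
    using finite_subset[OF CV finite_V] by (rule finite_imageI)
  \<comment> \<open>The root is always a common ancestor.\<close>
  have ne: "depth ` ?C \<noteq> {}"
    using reachable[OF assms(1)] reachable[OF assms(2)] by auto
  obtain m where m: "m \<in> ?C" "depth m = Max (depth ` ?C)"
    by (rule imageE[OF Max_in[OF fin ne]]) (rule that, assumption, erule sym)
  then have deepest: "depth b \<le> depth m" if "b \<in> ?C" for b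
    using Max_ge[OF fin, of "depth b"] that by simp
  then have greatest: "(b, m) \<in> E\<^sup>*" if "b \<in> ?C" for b
  proof -
    have "(m, b) \<in> E\<^sup>* \<or> (b, m) \<in> E\<^sup>*"
      using ancestors_comparable that m(1) by blast
    moreover have "m \<in> V"
      using m(1) CV by auto
    ultimately show ?thesis
      using ancestor_antisym[of m b] deepest[OF that] by auto
  qed
  have "\<exists>!a. (a, u) \<in> E\<^sup>* \<and> (a, v) \<in> E\<^sup>* \<and>
      (\<forall>b. (b, u) \<in> E\<^sup>* \<and> (b, v) \<in> E\<^sup>* \<longrightarrow> (b, a) \<in> E\<^sup>*)"
  proof (intro ex1I[of _ m])
    show "x = m" if "(x, u) \<in> E\<^sup>* \<and> (x, v) \<in> E\<^sup>* \<and>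
      (\<forall>b. (b, u) \<in> E\<^sup>* \<and> (b, v) \<in> E\<^sup>* \<longrightarrow> (b, x) \<in> E\<^sup>*)" for x
    proof (rule ancestor_antisym)
      have x: "(x, u) \<in> E\<^sup>*" and "(m, x) \<in> E\<^sup>*"
        using that m(1) by auto
      then show "x \<in> V" "(x, m) \<in> E\<^sup>*" "depth m \<le> depth x"
        using greatest[of x] that ancestor_in_V[OF x assms(1)] ancestor_in_V[OF _ assms(1)]
          m(1) depth_mono[of m x] by blast+
    qed
  qed (use m(1) greatest in blast)
  from theI'[OF this, folded lowest_common_ancestor_def, folded a_def]
  show "(a, u) \<in> E\<^sup>*" "(a, v) \<in> E\<^sup>*"
    "\<And>b. (b, u) \<in> E\<^sup>* \<Longrightarrow> (b, v) \<in> E\<^sup>* \<Longrightarrow> (b, a) \<in> E\<^sup>*"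
    by blast+
qed

section \<open>Heights of common ancestors of leaves\<close>

lemma leaf_no_descendant: "(l, v) \<in> E\<^sup>* \<Longrightarrow> l \<in> leaves V E \<Longrightarrow> v = l"
  by (erule converse_rtranclE) (auto simp: leaves_def)

lemma LCA_leaf_self:
  assumes "l \<in> leaves V E"
  shows "LCA V E l l = 0"
proof -
  have V: "l \<in> V"
    using assms by (simp add: leaves_def)
  \<comment> \<open>As \<open>l\<close> is a common ancestor of itself and itself, the lowest one is
    a descendant of \<open>l\<close>, and a leaf has no other.\<close>
  have "lowest_common_ancestor E l l = l"
    using lowest_common_ancestor_ancestor(3)[OF V V, of l] leaf_no_descendant[OF _ assms] by blast
  moreover have "{n. \<exists>l' \<in> leaves V E. (l, l') \<in> E ^^ n} = {0}"
  proof (intro set_eqI iffI)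
    fix n assume "n \<in> {n. \<exists>l' \<in> leaves V E. (l, l') \<in> E ^^ n}"
    then obtain l' where l': "(l, l') \<in> E ^^ n"
      by auto
    then have "l' = l"
      using leaf_no_descendant[OF _ assms] relpow_imp_rtrancl by blast
    then show "n \<in> {0}"
      using depth_path[OF V l'] by simp
  qed (use assms in auto)
  ultimately show ?thesis
    by (simp add: LCA_def height_def)
qed

text \<open>If the lowest common ancestor were \<open>u\<close>, the leaf \<open>u\<close> would
  have \<open>v\<close> as a proper descendant. So the path from it down to \<open>u\<close> has
  positive length, and this length bounds the height from below.\<close>

lemma LCA_leaves_pos:
  assumes u: "u \<in> leaves V E" and v: "v \<in> leaves V E" and "u \<noteq> v"
  shows "LCA V E u v > 0"
proof -
  define a where "a = lowest_common_ancestor E u v"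
  have V: "u \<in> V" "v \<in> V"
    using u v by (auto simp: leaves_def)
  have a: "(a, u) \<in> E\<^sup>*" "(a, v) \<in> E\<^sup>*"
    using lowest_common_ancestor_ancestor[OF V] by (auto simp: a_def)
  obtain n where n: "(a, u) \<in> E ^^ n"
    using a(1) rtrancl_power by blast
  have "a \<noteq> u"
    using leaf_no_descendant[OF _ u] a(2) \<open>u \<noteq> v\<close> by blast
  then have "n > 0"
    using n by (cases n) auto
  also have "n \<le> height V E a"
    unfolding height_def
    using finite_path_lengths[OF ancestor_in_V[OF a(1) V(1)]] n u by (intro Max_ge) auto
  finally show ?thesis
    by (simp add: LCA_def a_def)
qed

end

section \<open>Limits as \<beta> tends to infinity\<close>

lemma exp_neg_mult_tendsto:
  fixes d :: real
  assumes "d \<ge> 0"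
  shows "((\<lambda>\<beta>. exp (- \<beta> * d)) \<longlongrightarrow> (if d = 0 then 1 else 0)) at_top"
proof (cases "d = 0")
  case False
  then have "filterlim (\<lambda>\<beta>. \<beta> * d) at_top at_top"
    using assms by (intro filterlim_at_top_mult_tendsto_pos[OF tendsto_const _ filterlim_ident]) auto
  then have "((\<lambda>\<beta>. exp (- (\<beta> * d))) \<longlongrightarrow> 0) at_top"
    by (intro filterlim_compose[OF exp_at_bot]) (simp add: filterlim_uminus_at_bot)
  with False show ?thesis
    by simp
qed simp

lemma soft_label_tendsto:
  assumes "y \<in> {1..K}" "d y y = 0" and "\<And>j. j \<in> {1..K} \<Longrightarrow> j \<noteq> y \<Longrightarrow> d j y > 0"
    and "k \<in> {1..K}"
  shows "((\<lambda>\<beta>. soft_label K d \<beta> k y) \<longlongrightarrow> of_bool (k = y)) at_top"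
proof -
  have lim: "((\<lambda>\<beta>. exp (- \<beta> * d j y)) \<longlongrightarrow> of_bool (j = y)) at_top" if "j \<in> {1..K}" for j
    using exp_neg_mult_tendsto[of "d j y"] assms(2) assms(3)[OF that] by (cases "j = y") auto
  \<comment> \<open>Only the summand \<open>j = y\<close> survives, so the denominator tends to 1
    and the quotient has the limit of its numerator.\<close>
  have "((\<lambda>\<beta>. \<Sum>j = 1..K. exp (- \<beta> * d j y)) \<longlongrightarrow> (\<Sum>j = 1..K. of_bool (j = y))) at_top"
    by (intro tendsto_sum lim)
  also have "(\<Sum>j = 1..K. of_bool (j = y)) = (1 :: real)"
    using assms(1) by (simp add: of_bool_def)
  finally show ?thesis
    unfolding soft_label_def using tendsto_divide[OF lim[OF assms(4)]] by fastforce
qed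

lemma hierarchical_score_tendsto:
  assumes "y \<in> {1..K}" "d y y = 0" and "\<And>j. j \<in> {1..K} \<Longrightarrow> j \<noteq> y \<Longrightarrow> d j y > 0"
  shows "((\<lambda>\<beta>. hierarchical_score K d \<beta> p y) \<longlongrightarrow> - ln (p y)) at_top"
proof -
  have "((\<lambda>\<beta>. hierarchical_score K d \<beta> p y) \<longlongrightarrow>
      - (\<Sum>k = 1..K. of_bool (k = y) * ln (p k))) at_top"
    unfolding hierarchical_score_def
    by (intro tendsto_minus tendsto_sum tendsto_mult_right soft_label_tendsto assms)
  also have "(\<Sum>k = 1..K. of_bool (k = y) * ln (p k)) = ln (p y)"
    using assms(1) by (simp add: of_bool_def if_distrib[of "\<lambda>t. t * _"] cong: if_cong)
  finally show ?thesis .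
qed

theorem proposition4:
  fixes V :: "'v set" and E :: "('v \<times> 'v) set" and r :: 'v
    and K :: nat and leaf :: "nat \<Rightarrow> 'v"
    and f :: "nat \<Rightarrow> 'x \<Rightarrow> real" and yhat :: "'x \<Rightarrow> nat"
  assumes tree: "rooted_tree V E r"
    and height: "height V E r \<ge> 1"
    and classes: "bij_betw leaf {1..K} (leaves V E)"
    and f_pos: "\<And>k x. k \<in> {1..K} \<Longrightarrow> f k x > 0"
    and f_sum: "\<And>x. (\<Sum>k = 1..K. f k x) = 1"
    and yhat: "\<And>x. is_arg_max (\<lambda>k. f k x) (\<lambda>k. k \<in> {1..K}) (yhat x)"
  shows "\<forall>c::real. \<exists>c'>0. \<forall>x. \<exists>L::real.
           ((\<lambda>\<beta>. hierarchical_score K (\<lambda>i j. tree_dist V E r (leaf i) (leaf j)) \<beta>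
                   (\<lambda>k. f k x) (yhat x)) \<longlongrightarrow> L) at_top \<and>
           (L > c \<longleftrightarrow> (MAX k\<in>{1..K}. f k x) < c')"
\<comment> \<open>The witnesses stay schematic until the \<open>show\<close> commands fix them: that
  for \<open>c'\<close> may depend on \<open>c\<close> only, that for \<open>L\<close> also on
  \<open>x\<close>.\<close>
proof (intro allI exI conjI)
  interpret rooted_tree V E r
    by (rule tree)
  let ?d = "\<lambda>i j. tree_dist V E r (leaf i) (leaf j)"
  fix c :: real and x :: 'x
  show "exp (- c) > 0"
    by simp
  have y: "yhat x \<in> {1..K}" and y_max: "\<And>k. k \<in> {1..K} \<Longrightarrow> f k x \<le> f (yhat x) x"
    using yhat[of x] by (auto simp: is_arg_max_linorder)
  have leaf: "leaf k \<in> leaves V E" if "k \<in> {1..K}" for k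
    using bij_betwE[OF classes] that by blast
  have neq: "leaf k \<noteq> leaf (yhat x)" if "k \<in> {1..K}" "k \<noteq> yhat x" for k
    using bij_betw_imp_inj_on[OF classes] that y by (auto dest: inj_onD)
  show "((\<lambda>\<beta>. hierarchical_score K ?d \<beta> (\<lambda>k. f k x) (yhat x)) \<longlongrightarrow> - ln (f (yhat x) x)) at_top"
    \<comment> \<open>The bound \<open>height\<close> keeps the denominator of
      \<open>tree_dist\<close> positive, so distances inherit the sign of
      \<open>LCA\<close>.\<close>
    using y leaf neq height
    by (intro hierarchical_score_tendsto) (auto simp: tree_dist_def LCA_leaf_self LCA_leaves_pos)
  have "(MAX k\<in>{1..K}. f k x) = f (yhat x) x"
    using y y_max by (intro Max_eqI) auto
  \<comment> \<open>By strict monotonicity of \<open>ln\<close> on positive reals,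
    \<open>ln m < - c\<close> amounts to \<open>m < exp (- c)\<close>.\<close>
  then show "- ln (f (yhat x) x) > c \<longleftrightarrow> (MAX k\<in>{1..K}. f k x) < exp (- c)"
    using ln_less_cancel_iff[OF f_pos[OF y, of x], of "exp (- c)"] by auto
qed

end
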